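(* Let $(\mathcal J_m)_{m\in\omega}$ be tall analytic $P$-ideals on $\omega$ and let $\mathcal I=\bigcap_{m\in\omega}\mathcal J_m$. Then $\mathcal I$ does not have the Ramsey property. In fact, for each $X\in\mathcal I^+$ there is $Y\subseteq X$, $Y\in\mathcal I^+$, with $\mathcal{ED}_{\mathrm{fin}}\le_K\mathcal I\upharpoonright Y$.
   Context: All ideals on a countable set are proper and contain all finite sets; ideals on $\omega$ are viewed as subsets of $2^\omega\cong\mathcal P(\omega)$, so "analytic" makes sense. $\mathcal I^+=\mathcal P(\omega)\setminus\mathcal I$; $\mathcal I\upharpoonright Y=\{A\subseteq\omega:A\cap Y\in\mathcal I\}$. An ideal is tall if every infinite subset of $\omega$ has an infinite subset in the ideal. It is a $P$-ideal if for every sequence $(A_n)$ of its members there is a member $A$ with $A_n\setminus A$ finite for all $n$. $\mathcal I$ has the Ramsey property if for every $X\in\mathcal I^+$ and every $c:[X]^2\to2$ there is $Y\subseteq X$, $Y\in\mathcal I^+$, with $c\upharpoonright[Y]^2$ constant. For ideals $\mathcal I$ on $E$ and $\mathcal J$ on $D$, $\mathcal I\le_K\mathcal J$ means there is $f:D\to E$ with $f^{-1}[A]\in\mathcal J$ for all $A\in\mathcal I$. Let $\Delta=\{(n,m)\in\omega\times\omega:m\le n\}$; $\mathcal{ED}_{\mathrm{fin}}$ is the ideal on $\Delta$ of all $A\subseteq\Delta$ for which there are $k,n_0$ with $|\{m:(n,m)\in A\}|\le k$ for all $n\ge n_0$. *)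

theory Defs
  imports "HOL-Analysis.Analysis" "HOL-Library.Ramsey"
begin

definition ideal_on :: "'a set \<Rightarrow> 'a set set \<Rightarrow> bool" where
  "ideal_on E I \<longleftrightarrow>
     I \<subseteq> Pow E \<and>
     (\<forall>A\<in>I. \<forall>B. B \<subseteq> A \<longrightarrow> B \<in> I) \<and>
     (\<forall>A\<in>I. \<forall>B\<in>I. A \<union> B \<in> I) \<and>
     (\<forall>A. A \<subseteq> E \<and> finite A \<longrightarrow> A \<in> I) \<and>
     E \<notin> I"

definition positive_sets :: "nat set set \<Rightarrow> nat set set" where
  "positive_sets I = Pow UNIV - I"

text \<open>The restricted ideal is again a family of subsets of the whole of \<open>\<omega>\<close>, not of \<open>Y\<close>.\<close>

definition ideal_restrict :: "nat set set \<Rightarrow> nat set \<Rightarrow> nat set set" where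
  "ideal_restrict I Y = {A. A \<inter> Y \<in> I}"

definition tall :: "nat set set \<Rightarrow> bool" where
  "tall I \<longleftrightarrow> (\<forall>X. infinite X \<longrightarrow> (\<exists>Y. Y \<subseteq> X \<and> infinite Y \<and> Y \<in> I))"

definition P_ideal :: "nat set set \<Rightarrow> bool" where
  "P_ideal I \<longleftrightarrow>
     ideal_on UNIV I \<and>
     (\<forall>A :: nat \<Rightarrow> nat set. (\<forall>n. A n \<in> I) \<longrightarrow> (\<exists>B\<in>I. \<forall>n. finite (A n - B)))"

text \<open>A subset of Cantor space \<^typ>\<open>nat \<Rightarrow> bool\<close> (product topology, discrete factors) is analytic
  if it is empty or a continuous image of Baire space \<^typ>\<open>nat \<Rightarrow> nat\<close>. A family of sets of natural
  numbers is identified with the set of characteristic functions of its members.\<close>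

definition analytic_in_Cantor :: "(nat \<Rightarrow> bool) set \<Rightarrow> bool" where
  "analytic_in_Cantor S \<longleftrightarrow>
     S = {} \<or> (\<exists>f :: (nat \<Rightarrow> nat) \<Rightarrow> (nat \<Rightarrow> bool). continuous_on UNIV f \<and> range f = S)"

definition analytic_family :: "nat set set \<Rightarrow> bool" where
  "analytic_family I \<longleftrightarrow> analytic_in_Cantor ((\<lambda>A n. n \<in> A) ` I)"

definition Ramsey_property :: "nat set set \<Rightarrow> bool" where
  "Ramsey_property I \<longleftrightarrow>
     (\<forall>X \<in> positive_sets I. \<forall>c :: nat set \<Rightarrow> nat. c \<in> [X]\<^bsup>2\<^esup> \<rightarrow> {..<2} \<longrightarrow>
        (\<exists>Y. Y \<subseteq> X \<and> Y \<in> positive_sets I \<and> c constant_on [Y]\<^bsup>2\<^esup>))"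

text \<open>\<open>Katetov_le E I D J\<close> is \<open>I \<le>\<^sub>K J\<close> for families \<open>I\<close> on \<open>E\<close> and \<open>J\<close> on \<open>D\<close>.\<close>

definition Katetov_le :: "'a set \<Rightarrow> 'a set set \<Rightarrow> 'b set \<Rightarrow> 'b set set \<Rightarrow> bool" where
  "Katetov_le E I D J \<longleftrightarrow> (\<exists>f \<in> D \<rightarrow> E. \<forall>A\<in>I. f -` A \<inter> D \<in> J)"

definition Delta :: "(nat \<times> nat) set" where
  "Delta = {(n, m). m \<le> n}"

definition ED_fin :: "(nat \<times> nat) set set" where
  "ED_fin = {A. A \<subseteq> Delta \<and> (\<exists>k n0. \<forall>n\<ge>n0. card {m. (n, m) \<in> A} \<le> k)}"

lemma finite_Delta_section: "A \<subseteq> Delta \<Longrightarrow> finite {m. (n, m) \<in> A}"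
  by (rule finite_subset[of _ "{..n}"]) (auto simp: Delta_def)

lemma ideal_on_ED_fin: "ideal_on Delta ED_fin"
  unfolding ideal_on_def
proof (intro conjI ballI allI impI)
  show "ED_fin \<subseteq> Pow Delta"
    by (auto simp: ED_fin_def)
next
  fix A B assume A: "A \<in> ED_fin" and B: "B \<subseteq> A"
  then have "card {m. (n, m) \<in> B} \<le> card {m. (n, m) \<in> A}" for n
    by (intro card_mono finite_Delta_section) (auto simp: ED_fin_def)
  moreover obtain k n0 where "\<forall>n\<ge>n0. card {m. (n, m) \<in> A} \<le> k"
    using A unfolding ED_fin_def by auto
  ultimately have "\<forall>n\<ge>n0. card {m. (n, m) \<in> B} \<le> k"
    by (meson order_trans)
  with A B show "B \<in> ED_fin"
    unfolding ED_fin_def by auto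
next
  fix A B assume A: "A \<in> ED_fin" and B: "B \<in> ED_fin"
  then obtain k n0 k' n0' where k: "\<forall>n\<ge>n0. card {m. (n, m) \<in> A} \<le> k"
      and k': "\<forall>n\<ge>n0'. card {m. (n, m) \<in> B} \<le> k'"
    unfolding ED_fin_def by blast
  have "card {m. (n, m) \<in> A \<union> B} \<le> k + k'" if "n \<ge> max n0 n0'" for n
  proof -
    have "card {m. (n, m) \<in> A \<union> B} \<le> card {m. (n, m) \<in> A} + card {m. (n, m) \<in> B}"
      using card_Un_le[of "{m. (n, m) \<in> A}" "{m. (n, m) \<in> B}"] by (simp add: Collect_disj_eq)
    also have "\<dots> \<le> k + k'"
      using that k k' by (intro add_mono) auto
    finally show ?thesis .
  qed
  moreover have "A \<union> B \<subseteq> Delta"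
    using A B by (simp add: ED_fin_def)
  ultimately show "A \<union> B \<in> ED_fin"
    unfolding ED_fin_def by blast
next
  fix A assume A: "A \<subseteq> Delta \<and> finite A"
  have "card {m. (n, m) \<in> A} \<le> card A" for n
    using A by (intro card_inj_on_le[of "Pair n"]) (auto simp: inj_on_def)
  with A show "A \<in> ED_fin"
    unfolding ED_fin_def by blast
next
  have "card {m. (n, m) \<in> Delta} = Suc n" for n
    using card_atMost[of n] by (simp add: Delta_def atMost_def)
  then have "\<exists>n\<ge>n0. \<not> card {m. (n, m) \<in> Delta} \<le> k" for k n0
    by (intro exI[of _ "n0 + k"]) simp
  then show "Delta \<notin> ED_fin"
    unfolding ED_fin_def by simp
qed

lemma ideal_on_INT:
  fixes J :: "nat \<Rightarrow> 'a set set"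
  assumes "\<And>m. ideal_on E (J m)"
  shows "ideal_on E (\<Inter>m. J m)"
proof -
  have sub: "J m \<subseteq> Pow E"
    and down: "A \<in> J m \<Longrightarrow> B \<subseteq> A \<Longrightarrow> B \<in> J m"
    and un: "A \<in> J m \<Longrightarrow> B \<in> J m \<Longrightarrow> A \<union> B \<in> J m"
    and fin: "A \<subseteq> E \<Longrightarrow> finite A \<Longrightarrow> A \<in> J m"
    and proper: "E \<notin> J m" for A B m
    using assms[of m] by (simp_all add: ideal_on_def)
  show ?thesis
    unfolding ideal_on_def
  proof (intro conjI ballI allI impI)
    show "(\<Inter>m. J m) \<subseteq> Pow E"
      using sub[of 0] by blast
    show "E \<notin> (\<Inter>m. J m)"
      using proper[of 0] by (intro notI) (erule INT_E[of _ _ _ 0], simp_all)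
  qed (auto intro: down un fin)
qed

lemma ideal_on_restrict:
  assumes I: "ideal_on UNIV I" and "Y \<in> positive_sets I"
  shows "ideal_on UNIV (ideal_restrict I Y)"
  unfolding ideal_on_def
proof (intro conjI ballI allI impI)
  fix A B assume "A \<in> ideal_restrict I Y" "B \<subseteq> A"
  moreover from this have "B \<inter> Y \<subseteq> A \<inter> Y" by blast
  ultimately show "B \<in> ideal_restrict I Y"
    using I unfolding ideal_on_def ideal_restrict_def by (metis mem_Collect_eq)
next
  fix A B assume "A \<in> ideal_restrict I Y" "B \<in> ideal_restrict I Y"
  then show "A \<union> B \<in> ideal_restrict I Y"
    using I unfolding ideal_on_def ideal_restrict_def by (simp add: Int_Un_distrib2)
next
  fix A :: "nat set" assume "A \<subseteq> UNIV \<and> finite A"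
  then show "A \<in> ideal_restrict I Y"
    using I unfolding ideal_on_def ideal_restrict_def by simp
next
  show "UNIV \<notin> ideal_restrict I Y"
    using assms(2) by (simp add: ideal_restrict_def positive_sets_def)
qed simp

end

theory Submission
  imports Defs
begin

text \<open>Let \<open>J\<close> be a tall analytic \<open>P\<close>-ideal, the range of a continuous map \<open>F\<close> on Baire space.
  Whenever a subfamily cofinal in \<open>J\<close> modulo finite sets is split into countably many pieces, one
  piece is still cofinal, and by tallness the members containing \<open>i\<close> are still cofinal, for almost
  all \<open>i\<close>. Hence the points of a sufficiently sparse set can be forced one by one into \<open>F x\<close> while
  \<open>x\<close> is built up along finite sequences \<open>s\<close> with cofinal \<open>F[N\<^sub>s]\<close>: every sufficiently sparse
  set belongs to \<open>J\<close>. This replaces Solecki's representation by submeasures.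

  Given countably many such ideals, cut \<open>\<omega>\<close> into intervals whose lengths grow so fast that a set
  meeting each interval of one parity at most once, and no other interval, belongs to all of them.
  A positive \<open>X\<close> has a positive part \<open>Y\<close> in the intervals of one parity. Sending each interval into
  a column of \<open>\<Delta>\<close> gives the Katetov reduction; colouring pairs by whether they lie in the
  same interval refutes the Ramsey property.\<close>

section \<open>P-ideals and families cofinal modulo finite sets\<close>

lemma
  assumes "P_ideal J"
  shows P_ideal_subset: "A \<in> J \<Longrightarrow> B \<subseteq> A \<Longrightarrow> B \<in> J"
    and P_ideal_Un: "A \<in> J \<Longrightarrow> B \<in> J \<Longrightarrow> A \<union> B \<in> J"
    and P_ideal_finite: "finite A \<Longrightarrow> A \<in> J"
  using assms unfolding P_ideal_def ideal_on_def by auto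

definition almost_cofinal :: "nat set set \<Rightarrow> nat set set \<Rightarrow> bool" where
  "almost_cofinal J B \<longleftrightarrow> (\<forall>A\<in>J. \<exists>C\<in>B. finite (A - C))"

text \<open>If every piece failed, with witness \<open>A n\<close>, some \<open>D\<close> in
  \<open>J\<close> would almost contain all the \<open>A n\<close>. The piece with a member almost
  containing \<open>D\<close> then almost contains its own witness.\<close>

lemma almost_cofinal_UN:
  assumes "P_ideal J" and "almost_cofinal J (\<Union>n. B (n::nat))"
  shows "\<exists>n. almost_cofinal J (B n)"
proof (rule ccontr)
  assume "\<not> ?thesis"
  then have "\<forall>n. \<exists>A\<in>J. \<forall>C\<in>B n. infinite (A - C)"
    unfolding almost_cofinal_def by simp
  then obtain A where A: "\<And>n. A n \<in> J" "\<And>n C. C \<in> B n \<Longrightarrow> infinite (A n - C)"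
    by metis
  with assms(1) obtain D where "D \<in> J" and D: "\<And>n. finite (A n - D)"
    unfolding P_ideal_def by metis
  then obtain n C where C: "C \<in> B n" "finite (D - C)"
    using assms(2) unfolding almost_cofinal_def by blast
  have "A n - C \<subseteq> (A n - D) \<union> (D - C)" by blast
  with D C have "finite (A n - C)"
    by (meson finite_UnI finite_subset)
  with A C show False by blast
qed

text \<open>If infinitely many \<open>i\<close> failed, tallness would give an infinite
  \<open>Z\<close> in \<open>J\<close> of such \<open>i\<close>, and some \<open>D\<close> in
  \<open>J\<close> would almost contain their witnesses \<open>A i\<close>. A member
  \<open>C\<close> of \<open>B\<close> almost containing \<open>D\<close> and \<open>Z\<close>
  contains a point \<open>i\<close> of \<open>Z\<close>, and it almost contains
  \<open>A i\<close>.\<close>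

lemma almost_cofinal_eventually_mem:
  assumes J: "P_ideal J" and "tall J" and B: "almost_cofinal J B"
  shows "\<exists>n. \<forall>i\<ge>n. almost_cofinal J {C \<in> B. i \<in> C}"
proof (rule ccontr)
  assume "\<not> ?thesis"
  then have "infinite {i. \<not> almost_cofinal J {C \<in> B. i \<in> C}}"
    unfolding infinite_nat_iff_unbounded_le by blast
  with \<open>tall J\<close> obtain Z where Z: "infinite Z" "Z \<in> J"
      and "\<forall>i\<in>Z. \<not> almost_cofinal J {C \<in> B. i \<in> C}"
    unfolding tall_def by blast
  then have "\<forall>i\<in>Z. \<exists>A\<in>J. \<forall>C\<in>B. i \<in> C \<longrightarrow> infinite (A - C)"
    unfolding almost_cofinal_def by blast
  then obtain A where A: "\<And>i. i \<in> Z \<Longrightarrow> A i \<in> J"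
      "\<And>i C. i \<in> Z \<Longrightarrow> C \<in> B \<Longrightarrow> i \<in> C \<Longrightarrow> infinite (A i - C)"
    by metis
  \<comment> \<open>The P-property needs a sequence indexed by all of \<omega>; off \<open>Z\<close>
    any member of \<open>J\<close> serves as a default.\<close>
  define A' where "A' i = (if i \<in> Z then A i else Z)" for i
  have "\<forall>i. A' i \<in> J"
    using A Z by (simp add: A'_def)
  with J obtain D where D: "D \<in> J" "\<And>i. finite (A' i - D)"
    unfolding P_ideal_def by metis
  have "D \<union> Z \<in> J"
    using J D Z P_ideal_Un by blast
  then obtain C where C: "C \<in> B" "finite (D \<union> Z - C)"
    using B unfolding almost_cofinal_def by blast
  have "\<not> Z \<subseteq> D \<union> Z - C"
    using Z C finite_subset by blast
  then obtain i where i: "i \<in> Z" "i \<in> C" by blast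
  have "A i - C \<subseteq> (A' i - D) \<union> (D \<union> Z - C)"
    using i by (auto simp: A'_def)
  with C D have "finite (A i - C)"
    by (meson finite_UnI finite_subset)
  with A C i show False by blast
qed

section \<open>Sparse sets belong to a tall analytic P-ideal\<close>

lemma open_Baire_contains_cylinder:
  fixes U :: "(nat \<Rightarrow> nat) set"
  assumes "open U" and "x \<in> U"
  shows "\<exists>n. \<forall>y. (\<forall>i<n. y i = x i) \<longrightarrow> y \<in> U"
proof -
  obtain X where X: "x \<in> (\<Pi>\<^sub>E i\<in>UNIV. X i)" "finite {i. X i \<noteq> UNIV}" "(\<Pi>\<^sub>E i\<in>UNIV. X i) \<subseteq> U"
    using product_topology_open_contains_basis[of "\<lambda>_. euclidean" UNIV U x] assms
    unfolding open_fun_def by auto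
  from X(2) obtain n where n: "\<And>i. X i \<noteq> UNIV \<Longrightarrow> i < n"
    unfolding finite_nat_set_iff_bounded by auto
  have "y \<in> U" if "\<forall>i<n. y i = x i" for y
  proof -
    have "y i \<in> X i" for i
      using X(1) n[of i] that by (cases "X i = UNIV") (auto simp: PiE_def Pi_def)
    with X(3) show ?thesis by (auto simp: PiE_def Pi_def)
  qed
  then show ?thesis by blast
qed

lemma tall_analytic_P_ideal_sparse_sets:
  assumes J: "P_ideal J" and "tall J" and "analytic_family J"
  shows "\<exists>g. \<forall>z. (\<forall>n. g (z n) \<le> z (Suc n)) \<longrightarrow> range z \<in> J"
proof -
  have "{} \<in> J"
    using P_ideal_finite[OF J] by simp
  with \<open>analytic_family J\<close> obtain f :: "(nat \<Rightarrow> nat) \<Rightarrow> nat \<Rightarrow> bool" where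
    f: "continuous_on UNIV f" "range f = (\<lambda>A n. n \<in> A) ` J"
    unfolding analytic_family_def analytic_in_Cantor_def by auto
  define F where "F x = {n. f x n}" for x
  have rangeF: "range F = J"
  proof -
    have "range F = Collect ` range f"
      unfolding F_def by auto
    then show ?thesis
      unfolding f(2) image_image by simp
  qed
  \<comment> \<open>\<open>s\<close> fixes an initial segment of \<open>x\<close>, and
    \<open>D\<close> collects the points forced into \<open>F x\<close> so far.\<close>
  define B where "B s D = {F x |x. (\<forall>i<length s. x i = s ! i) \<and> D \<subseteq> F x}" for s :: "nat list" and D
  have step: "\<exists>n. \<forall>i\<ge>n. \<exists>a. almost_cofinal J (B (s @ [a]) (insert i D))" if cof: "almost_cofinal J (B s D)" for s D
  proof -
    obtain n where n: "\<And>i. i \<ge> n \<Longrightarrow> almost_cofinal J {C \<in> B s D. i \<in> C}"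
      using almost_cofinal_eventually_mem[OF J \<open>tall J\<close> cof] by blast
    have "\<exists>a. almost_cofinal J (B (s @ [a]) (insert i D))" if "i \<ge> n" for i
    proof (rule almost_cofinal_UN[OF J])
      \<comment> \<open>The family is split by the coordinate of \<open>x\<close> that follows
        \<open>s\<close>.\<close>
      have "{C \<in> B s D. i \<in> C} = (\<Union>a. B (s @ [a]) (insert i D))"
        by (auto simp: B_def less_Suc_eq nth_append)
      with n[OF that] show "almost_cofinal J (\<Union>a. B (s @ [a]) (insert i D))" by simp
    qed
    then show ?thesis by blast
  qed
  then obtain b e where
    step: "\<And>s D i. almost_cofinal J (B s D) \<Longrightarrow> i \<ge> b s D \<Longrightarrow> almost_cofinal J (B (s @ [e s D i]) (insert i D))"
    by metis
  \<comment> \<open>A history lists the points played so far, latest first.\<close>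
  define st :: "nat list \<Rightarrow> nat list" where
    "st = rec_list [] (\<lambda>i h s. s @ [e s (set h) i])"
  have st: "st [] = []" "st (i # h) = st h @ [e (st h) (set h) i]" for i h
    by (simp_all add: st_def)
  \<comment> \<open>The bound \<open>b\<close> depends on the whole history, but an increasing
    history ending in \<open>z\<close> has entries at most \<open>z\<close> and length at most
    \<open>Suc z\<close>. There are finitely many of these, so a function of the last point
    dominates. The summand \<open>Suc z\<close> makes the sequences strictly increasing.\<close>
  define g where
    "g z = Suc z + Max ((\<lambda>h. b (st h) (set h)) ` {h. set h \<subseteq> {..z} \<and> length h \<le> Suc z})" for z
  have g: "b (st h) (set h) \<le> g z" if "set h \<subseteq> {..z}" "length h \<le> Suc z" for h z
    using that unfolding g_def
    by (intro trans_le_add2 Max_ge finite_imageI finite_lists_length_le) auto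
  have g_less: "z < g z" for z
    by (simp add: g_def)
  have main: "range z \<in> J" if z0: "b [] {} \<le> z 0" and z: "\<And>n. g (z n) \<le> z (Suc n)" for z
  proof -
    have "strict_mono z"
      using g_less z by (intro strict_mono_Suc_iff[THEN iffD2] allI) (meson less_le_trans)
    define h where "h n = rev (map z [0..<n])" for n
    have h: "h 0 = []" "h (Suc n) = z n # h n" "set (h n) = z ` {..<n}" "length (h n) = n" for n
      by (auto simp: h_def atLeast0LessThan)
    have bound: "b (st (h n)) (set (h n)) \<le> z n" for n
    proof (cases n)
      case 0
      with z0 show ?thesis by (simp add: h st)
    next
      case (Suc k)
      have "set (h n) \<subseteq> {..z k}"
        using \<open>strict_mono z\<close> Suc by (auto simp: h strict_mono_less_eq)
      moreover have "length (h n) \<le> Suc (z k)"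
        using strict_mono_imp_increasing[OF \<open>strict_mono z\<close>] Suc by (simp add: h)
      ultimately show ?thesis
        using g z[of k] Suc by (meson order_trans)
    qed
    have cof: "almost_cofinal J (B (st (h n)) (set (h n)))" for n
    proof (induction n)
      case 0
      have "B [] {} = J"
        using rangeF by (auto simp: B_def)
      then show ?case
        by (auto simp: h st almost_cofinal_def intro!: bexI)
    next
      case (Suc n)
      from step[OF Suc bound] show ?case by (simp add: h(2) st)
    qed
    have len: "length (st (h n)) = n" for n
      by (induction n) (simp_all add: h st)
    \<comment> \<open>The lists \<open>st (h n)\<close> extend one another; \<open>x\<close> is the
      branch through them.\<close>
    define x where "x n = st (h (Suc n)) ! n" for n
    have nth: "i < n \<Longrightarrow> st (h n) ! i = x i" for i n
    proof (induction n)
      case (Suc n)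
      then show ?case
        by (cases "i = n") (simp_all add: x_def h(2) st nth_append len)
    qed simp
    \<comment> \<open>Otherwise continuity gives a cylinder around \<open>x\<close> on which
      \<open>z k\<close> is never in \<open>F y\<close>. A long enough \<open>st (h m)\<close> lies
      in it, yet cofinality makes \<open>B (st (h m)) (set (h m))\<close> nonempty, which yields
      such a \<open>y\<close> with \<open>z k\<close> in \<open>F y\<close>.\<close>
    have "z k \<in> F x" for k
    proof (rule ccontr)
      assume "z k \<notin> F x"
      have "continuous_on UNIV (\<lambda>y. f y (z k))"
        by (rule continuous_on_product_then_coordinatewise[OF f(1)])
      then have "open ((\<lambda>y. f y (z k)) -` {False})"
        by (rule open_vimage[rotated]) (simp add: open_discrete)
      moreover have "x \<in> (\<lambda>y. f y (z k)) -` {False}"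
        using \<open>z k \<notin> F x\<close> by (simp add: F_def)
      ultimately obtain n where n: "\<And>y. (\<forall>i<n. y i = x i) \<Longrightarrow> y \<in> (\<lambda>y. f y (z k)) -` {False}"
        using open_Baire_contains_cylinder[of "(\<lambda>y. f y (z k)) -` {False}" x] by blast
      define m where "m = max n (Suc k)"
      have "B (st (h m)) (set (h m)) \<noteq> {}"
        using cof[of m] \<open>{} \<in> J\<close> unfolding almost_cofinal_def by (metis ex_in_conv)
      then obtain y where "\<forall>i<length (st (h m)). y i = st (h m) ! i" "set (h m) \<subseteq> F y"
        unfolding B_def by blast
      then have y: "\<And>i. i < m \<Longrightarrow> y i = x i" "z ` {..<m} \<subseteq> F y"
        by (simp_all add: len nth h(3))
      have "z k \<in> F y"
        using y(2) by (rule subsetD) (simp add: m_def)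
      then have "f y (z k)"
        by (simp add: F_def)
      moreover have "y \<in> (\<lambda>y. f y (z k)) -` {False}"
        by (rule n) (simp add: y(1) m_def)
      ultimately show False by simp
    qed
    then have "range z \<subseteq> F x" by blast
    then show ?thesis
      using P_ideal_subset[OF J] rangeF by blast
  qed
  \<comment> \<open>The condition constrains only the points after \<open>z 0\<close>. So
    \<open>main\<close> is applied to the shifted sequence, and \<open>z 0\<close> is added back as
    a finite set.\<close>
  define G where "G n = max (g n) (b [] {})" for n
  have "range z \<in> J" if "\<forall>n. G (z n) \<le> z (Suc n)" for z
  proof -
    have "range (\<lambda>n. z (Suc n)) \<in> J"
      using that by (intro main) (auto simp: G_def)
    moreover have "range z = {z 0} \<union> range (\<lambda>n. z (Suc n))"
      by (subst UNIV_nat_eq) (simp add: image_image)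
    ultimately show ?thesis
      using P_ideal_Un[OF J P_ideal_finite[OF J, of "{z 0}"]] by simp
  qed
  then show ?thesis by blast
qed

section \<open>The interval partition for countably many ideals\<close>

text \<open>A whole interval separates two intervals of the same parity, and its right end exceeds
  the values of \<open>g m\<close> at all earlier points. So one point per interval of a fixed
  parity makes a sparse sequence.\<close>

lemma INT_tall_analytic_P_ideals_partition:
  fixes J :: "nat \<Rightarrow> nat set set"
  assumes P: "\<And>m. P_ideal (J m)" and "\<And>m. tall (J m)" and "\<And>m. analytic_family (J m)"
  obtains p q :: "nat \<Rightarrow> nat" where "strict_mono p"
    and "\<And>x. p (q x) \<le> x \<and> x < p (Suc (q x))"
    and "\<And>Z e. inj_on q Z \<Longrightarrow> \<forall>x\<in>Z. even (q x) = e \<Longrightarrow> Z \<in> (\<Inter>m. J m)"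
proof -
  obtain g where g: "\<And>m z. (\<And>n. g m (z n) \<le> z (Suc n)) \<Longrightarrow> range z \<in> J m"
    using tall_analytic_P_ideal_sparse_sets[OF assms] by metis
  \<comment> \<open>The growth condition of \<open>J m\<close> is imposed from the \<open>m\<close>-th interval on only.\<close>
  define p where "p = rec_nat (0::nat) (\<lambda>n x. Suc x + (\<Sum>m\<le>n. \<Sum>y\<le>x. g m y))"
  have p: "p 0 = 0" "p (Suc n) = Suc (p n) + (\<Sum>m\<le>n. \<Sum>y\<le>p n. g m y)" for n
    by (simp_all add: p_def)
  have mono: "strict_mono p"
    by (simp add: strict_mono_Suc_iff p)
  have gp: "g m y \<le> p (Suc n)" if "m \<le> n" "y \<le> p n" for m n y
  proof -
    have "g m y \<le> (\<Sum>y\<le>p n. g m y)"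
      using that by (intro member_le_sum) auto
    also have "\<dots> \<le> (\<Sum>m\<le>n. \<Sum>y\<le>p n. g m y)"
      using that by (intro member_le_sum[of _ _ "\<lambda>m. \<Sum>y\<le>p n. g m y"]) auto
    finally show ?thesis by (simp add: p)
  qed
  define q where "q x = (LEAST k. x < p (Suc k))" for x
  have upper: "x < p (Suc (q x))" for x
    unfolding q_def
    by (rule LeastI[of _ x])
      (use strict_mono_imp_increasing[OF mono, of "Suc x"] in simp)
  have lower: "p (q x) \<le> x" for x
  proof (cases "q x")
    case (Suc k)
    then have "\<not> x < p (Suc k)"
      using not_less_Least[of k "\<lambda>k. x < p (Suc k)"] by (simp add: q_def)
    with Suc show ?thesis by simp
  qed (simp add: p)
  have "Z \<in> J m" if inj: "inj_on q Z" and par: "\<forall>x\<in>Z. even (q x) = e" for Z e m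
  proof -
    define r where "r n = 2 * n + (if e then 0 else 1)" for n :: nat
    \<comment> \<open>Intervals of this parity that miss \<open>Z\<close> contribute their left
      endpoint, so that \<open>z\<close> has one point in each.\<close>
    define z where "z n = (if \<exists>x\<in>Z. q x = r n then SOME x. x \<in> Z \<and> q x = r n else p (r n))" for n
    have z_in: "p (r n) \<le> z n \<and> z n < p (Suc (r n))" for n
    proof (cases "\<exists>x\<in>Z. q x = r n")
      case True
      then have "z n \<in> Z \<and> q (z n) = r n"
        unfolding z_def using someI_ex[of "\<lambda>x. x \<in> Z \<and> q x = r n"] by auto
      then show ?thesis using lower[of "z n"] upper[of "z n"] by simp
    qed (auto simp: z_def strict_mono_less[OF mono])
    have "x \<in> range z" if "x \<in> Z" for x
    proof -
      have "r (q x div 2) = q x"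
        using par that by (auto simp: r_def)
      moreover from this have "(SOME y. y \<in> Z \<and> q y = q x) = x"
        using inj that by (intro some_equality) (auto dest: inj_onD)
      ultimately have "z (q x div 2) = x"
        using that by (auto simp: z_def)
      then show ?thesis by (metis rangeI)
    qed
    \<comment> \<open>The first \<open>m\<close> terms are split off because \<open>p\<close>
      dominates \<open>g m\<close> only from index \<open>m\<close> on.\<close>
    then have Z: "Z \<subseteq> z ` {..<m} \<union> range (\<lambda>n. z (n + m))"
    proof (intro subsetI)
      fix x assume "x \<in> Z"
      with \<open>\<And>x. x \<in> Z \<Longrightarrow> x \<in> range z\<close> obtain n where "x = z n" by blast
      then show "x \<in> z ` {..<m} \<union> range (\<lambda>n. z (n + m))"
        by (cases "n < m") (auto simp: image_iff intro: exI[of _ "n - m"])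
    qed
    have "range (\<lambda>n. z (n + m)) \<in> J m"
    proof (rule g)
      fix n
      have "g m (z (n + m)) \<le> p (Suc (Suc (r (n + m))))"
        using z_in[of "n + m"] by (intro gp) (auto simp: r_def)
      also have "\<dots> = p (r (Suc n + m))"
        by (simp add: r_def)
      also have "\<dots> \<le> z (Suc n + m)"
        using z_in by blast
      finally show "g m (z (n + m)) \<le> z (Suc n + m)" .
    qed
    then have "z ` {..<m} \<union> range (\<lambda>n. z (n + m)) \<in> J m"
      by (rule P_ideal_Un[OF P P_ideal_finite[OF P], rotated]) simp
    with Z show ?thesis
      using P P_ideal_subset by blast
  qed
  then show thesis
    using that[OF mono, of q] upper lower by blast
qed

text \<open>Induction on \<open>k\<close>: the least points of the nonempty sections form a
  selector, and removing them lowers the bound by one. For \<open>k = 0\<close> only the finite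
  sections below \<open>n0\<close> remain.\<close>

lemma bounded_sections_in_ideal:
  assumes I: "ideal_on UNIV (I :: nat set set)"
    and fin: "\<And>n::nat. finite {x. q x = n}"
    and selector: "\<And>Z. Z \<subseteq> Y \<Longrightarrow> inj_on q Z \<Longrightarrow> Z \<in> I"
    and "W \<subseteq> Y" and "\<And>n. n \<ge> n0 \<Longrightarrow> card {x \<in> W. q x = n} \<le> k"
  shows "W \<in> I"
  using assms(4,5)
proof (induction k arbitrary: W)
  case 0
  then have "card {x \<in> W. q x = n} = 0" if "n \<ge> n0" for n
    using that by simp
  then have "{x \<in> W. q x = n} = {}" if "n \<ge> n0" for n
    using that fin[of n] by (metis (no_types, lifting) card_0_eq finite_subset Collect_mono)
  then have "W \<subseteq> (\<Union>n<n0. {x. q x = n})"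
    by (fastforce simp: not_less[symmetric])
  then have "finite W"
    using fin by (meson finite_UN finite_lessThan finite_subset)
  with I show ?case by (simp add: ideal_on_def)
next
  case (Suc k)
  define Z where "Z = {x \<in> W. \<forall>y\<in>W. q y = q x \<longrightarrow> x \<le> y}"
  have "Z \<in> I"
    using Suc.prems(1) by (intro selector) (auto simp: Z_def inj_on_def intro: antisym)
  moreover have "W - Z \<in> I"
  proof (rule Suc.IH)
    fix n assume n: "n \<ge> n0"
    let ?S = "{x \<in> W. q x = n}"
    have finS: "finite ?S"
      using fin[of n] by (rule finite_subset[rotated]) auto
    show "card {x \<in> W - Z. q x = n} \<le> k"
    proof (cases "?S = {}")
      case True
      then have "{x \<in> W - Z. q x = n} = {}" by blast
      then show ?thesis by (metis card.empty le0)
    next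
      case False
      have "Min ?S \<in> ?S"
        using finS False by (rule Min_in)
      moreover have "\<And>y. y \<in> ?S \<Longrightarrow> Min ?S \<le> y"
        using finS by (rule Min_le)
      ultimately have "Min ?S \<in> Z"
        by (auto simp: Z_def)
      then have "{x \<in> W - Z. q x = n} \<subseteq> ?S - {Min ?S}" by auto
      then have "card {x \<in> W - Z. q x = n} \<le> card (?S - {Min ?S})"
        using finS by (intro card_mono) auto
      also have "\<dots> = card ?S - 1"
        using \<open>Min ?S \<in> ?S\<close> by (rule card_Diff_singleton)
      also have "\<dots> \<le> k"
        using Suc.prems(2)[OF n] by simp
      finally show ?thesis .
    qed
  qed (use Suc.prems in auto)
  ultimately have "Z \<union> (W - Z) \<in> I"
    using I unfolding ideal_on_def by blast
  then show ?case
    using I by (simp add: ideal_on_def)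
qed

section \<open>Katetov reduction and failure of the Ramsey property\<close>

theorem theorem3p1:
  fixes J :: "nat \<Rightarrow> nat set set" and I :: "nat set set"
  assumes "\<And>m. P_ideal (J m)"
    and "\<And>m. tall (J m)"
    and "\<And>m. analytic_family (J m)"
    and "I = (\<Inter>m. J m)"
  shows "\<not> Ramsey_property I \<and>
    (\<forall>X \<in> positive_sets I. \<exists>Y. Y \<subseteq> X \<and> Y \<in> positive_sets I \<and>
       Katetov_le Delta ED_fin UNIV (ideal_restrict I Y))"
proof -
  have I: "ideal_on UNIV I"
    unfolding assms(4) using assms(1) by (intro ideal_on_INT) (simp add: P_ideal_def)
  then have I_Un: "A \<in> I \<Longrightarrow> B \<in> I \<Longrightarrow> A \<union> B \<in> I"
    and I_finite: "finite A \<Longrightarrow> A \<in> I" and "UNIV \<notin> I" for A B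
    by (auto simp: ideal_on_def)
  obtain p q :: "nat \<Rightarrow> nat" where p: "strict_mono p"
    and q: "\<And>x. p (q x) \<le> x \<and> x < p (Suc (q x))"
    and sel: "\<And>Z e. inj_on q Z \<Longrightarrow> \<forall>x\<in>Z. even (q x) = e \<Longrightarrow> Z \<in> I"
    using INT_tall_analytic_P_ideals_partition[of J, OF assms(1-3), folded assms(4)] by blast
  have fin: "finite {x. q x = n}" for n
    by (rule finite_subset[of _ "{..<p (Suc n)}"]) (use q in auto)
  define half where "half X e = {x \<in> X. even (q x) = e}" for X e
  have sel': "Z \<in> I" if "Z \<subseteq> half X e" "inj_on q Z" for Z X e
    using that by (intro sel[of Z e]) (auto simp: half_def)
  have half: "\<exists>e. half X e \<notin> I" if "X \<notin> I" for X
  proof -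
    have "X = half X True \<union> half X False"
      by (auto simp: half_def)
    with that I_Un[of "half X True" "half X False"] show ?thesis by auto
  qed
  have Katetov: "Katetov_le Delta ED_fin UNIV (ideal_restrict I (half X e))" for X e
    unfolding Katetov_le_def
  \<comment> \<open>The right endpoint of its interval exceeds \<open>x\<close>, so the pair lies in
    \<open>Delta\<close>. A section of the preimage of \<open>A\<close> is contained in a column
    section of \<open>A\<close>, whose index \<open>p (Suc n)\<close> is at least
    \<open>n\<close>.\<close>
  proof (intro bexI[of _ "\<lambda>x. (p (Suc (q x)), x)"] ballI)
    show "(\<lambda>x. (p (Suc (q x)), x)) \<in> UNIV \<rightarrow> Delta"
      using q by (auto simp: Delta_def less_imp_le)
    fix A assume "A \<in> ED_fin"
    then obtain k n0 where A: "A \<subseteq> Delta" and k: "\<And>n. n \<ge> n0 \<Longrightarrow> card {m. (n, m) \<in> A} \<le> k"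
      unfolding ED_fin_def by auto
    let ?W = "(\<lambda>x. (p (Suc (q x)), x)) -` A \<inter> half X e"
    have "?W \<in> I"
    proof (rule bounded_sections_in_ideal[OF I fin sel'])
      fix n assume "n \<ge> n0"
      also have "n \<le> p (Suc n)"
        using strict_mono_imp_increasing[OF p, of "Suc n"] by simp
      finally have "card {m. (p (Suc n), m) \<in> A} \<le> k"
        by (rule k)
      moreover have "card {x \<in> ?W. q x = n} \<le> card {m. (p (Suc n), m) \<in> A}"
        using A by (intro card_mono finite_Delta_section) auto
      ultimately show "card {x \<in> ?W. q x = n} \<le> k" by linarith
    qed auto
    then show "(\<lambda>x. (p (Suc (q x)), x)) -` A \<inter> UNIV \<in> ideal_restrict I (half X e)"
      by (simp add: ideal_restrict_def)
  qed
  have "\<not> Ramsey_property I"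
  proof
    assume ramsey: "Ramsey_property I"
    obtain e where e: "half UNIV e \<notin> I"
      using half \<open>UNIV \<notin> I\<close> by blast
    \<comment> \<open>A set homogeneous in colour 0 lies in one interval and is finite; one in
      colour 1 is a selector, which is in \<open>I\<close> inside a half.\<close>
    define c :: "nat set \<Rightarrow> nat" where "c S = (if inj_on q S then 1 else 0)" for S
    have "c \<in> [half UNIV e]\<^bsup>2\<^esup> \<rightarrow> {..<2}"
      by (auto simp: c_def)
    with ramsey e obtain Y where Y: "Y \<subseteq> half UNIV e" "Y \<notin> I" "c constant_on [Y]\<^bsup>2\<^esup>"
      unfolding Ramsey_property_def positive_sets_def by blast
    then obtain v where "\<forall>S\<in>[Y]\<^bsup>2\<^esup>. c S = v"
      unfolding constant_on_def by blast
    then have v: "c {x, y} = v" if "x \<in> Y" "y \<in> Y" "x \<noteq> y" for x y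
      using that by (auto simp: nsets_def)
    show False
    proof (cases "v = 0")
      case True
      have "finite Y"
      proof (cases "Y = {}")
        case False
        then obtain x where x: "x \<in> Y" by blast
        have "q y = q x" if "y \<in> Y" for y
          using v[OF x that] True by (cases "x = y") (auto simp: c_def split: if_splits)
        then have "Y \<subseteq> {y. q y = q x}" by blast
        then show ?thesis
          using fin finite_subset by blast
      qed simp
      with I_finite Y show False by blast
    next
      case False
      have "inj_on q Y"
      proof (rule inj_onI, rule ccontr)
        fix x y assume "x \<in> Y" "y \<in> Y" "q x = q y" "x \<noteq> y"
        with v[of x y] False show False
          by (auto simp: c_def)
      qed
      with sel' Y show False by blast
    qed
  qed
  moreover have "\<exists>Y. Y \<subseteq> X \<and> Y \<in> positive_sets I \<and>
      Katetov_le Delta ED_fin UNIV (ideal_restrict I Y)" if X: "X \<in> positive_sets I" for X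
  proof -
    from X have "X \<notin> I" by (simp add: positive_sets_def)
    from half[OF this] obtain e where "half X e \<notin> I" ..
    moreover have "half X e \<subseteq> X"
      by (auto simp: half_def)
    ultimately show ?thesis
      using Katetov by (intro exI[of _ "half X e"]) (simp add: positive_sets_def)
  qed
  ultimately show ?thesis by blast
qed

end
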